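(* Let $q\ge 3$ and $k\ge 2$ be integers. For the spiro-chain $S_{q,1,k}$ we have $$ABC(S_{q,1,k})=\frac{qk-k+2}{\sqrt{2}}+\frac{(k-2)\sqrt{6}}{4}.$$
   Context: For a finite simple graph $G$, $ABC(G)=\sum_{uv\in E(G)}\sqrt{\frac{d_u+d_v-2}{d_ud_v}}$, where $d_u$ is the degree of $u$ in $G$ (atom-bond connectivity index). The spiro-chain $S_{q,h,k}$ is the chain of $k$ cycles $C_q$ in which the distance between two consecutive contact vertices is $h$: take $k$ disjoint copies $C^{(1)},\ldots,C^{(k)}$ of the cycle $C_q$, in each $C^{(i)}$ choose vertices $x_i,y_i$ at distance $h$, and identify $y_i$ with $x_{i+1}$ for $i=1,\ldots,k-1$. *)

theory Defs
  imports Complex_Main "HOL-Library.Extended_Nat"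
begin

text \<open>A simple graph is given by its vertices and its edges, the latter as two-element vertex sets.\<close>

record 'a ugraph =
  verts :: "'a set"
  edges :: "'a set set"

definition degree :: "'a ugraph \<Rightarrow> 'a \<Rightarrow> nat" where
  "degree G v = card {e \<in> edges G. v \<in> e}"

text \<open>For an edge \<open>e = {u, v}\<close> the inner sum is \<open>d\<^sub>u + d\<^sub>v\<close> and the inner product is \<open>d\<^sub>u d\<^sub>v\<close>.\<close>

definition ABC :: "'a ugraph \<Rightarrow> real" where
  "ABC G = (\<Sum>e\<in>edges G.
     sqrt (((\<Sum>v\<in>e. real (degree G v)) - 2) / (\<Prod>v\<in>e. real (degree G v))))"

text \<open>The pair \<open>(u, v)\<close> lies in the \<open>n\<close>-th relational power of adjacency iff there is a walk of
  length \<open>n\<close> from \<open>u\<close> to \<open>v\<close>; vertices not joined by a walk have distance \<open>\<infinity>\<close>.\<close>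

definition graph_dist :: "'a ugraph \<Rightarrow> 'a \<Rightarrow> 'a \<Rightarrow> enat" where
  "graph_dist G u v = (INF n\<in>{n. (u, v) \<in> {(a, b). {a, b} \<in> edges G} ^^ n}. enat n)"

definition cycle_graph :: "nat \<Rightarrow> nat ugraph" where
  "cycle_graph q = \<lparr>verts = {..<q}, edges = {{i, (i + 1) mod q} | i. i < q}\<rparr>"

definition disjoint_copies :: "nat \<Rightarrow> 'a ugraph \<Rightarrow> (nat \<times> 'a) ugraph" where
  "disjoint_copies k G =
     \<lparr>verts = {..<k} \<times> verts G, edges = {Pair i ` e | i e. i < k \<and> e \<in> edges G}\<rparr>"

text \<open>The vertices of the quotient are the classes of the equivalence relation generated by \<open>R\<close>.\<close>

definition identify :: "('a \<Rightarrow> 'a \<Rightarrow> bool) \<Rightarrow> 'a ugraph \<Rightarrow> 'a set ugraph" where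
  "identify R G =
     (let cls = (\<lambda>v. {w. equivclp R v w})
      in \<lparr>verts = cls ` verts G, edges = (\<lambda>e. cls ` e) ` edges G\<rparr>)"

text \<open>Copies are numbered from \<open>0\<close> to \<open>k - 1\<close>. The contact vertices of copy \<open>i\<close> are \<open>x i\<close> and
  \<open>y i\<close>, and \<open>y i\<close> in copy \<open>i\<close> is identified with \<open>x (i + 1)\<close> in copy \<open>i + 1\<close>.\<close>

definition chain_of_cycles ::
  "nat \<Rightarrow> nat \<Rightarrow> (nat \<Rightarrow> nat) \<Rightarrow> (nat \<Rightarrow> nat) \<Rightarrow> (nat \<times> nat) set ugraph" where
  "chain_of_cycles q k x y =
     identify (\<lambda>a b. \<exists>i. i + 1 < k \<and> a = (i, y i) \<and> b = (i + 1, x (i + 1)))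
       (disjoint_copies k (cycle_graph q))"

text \<open>The spiro-chain is determined only by the choice of contact vertices at distance \<open>h\<close> in each
  copy, so we collect the graphs arising from all such choices.\<close>

definition spiro_chains :: "nat \<Rightarrow> nat \<Rightarrow> nat \<Rightarrow> (nat \<times> nat) set ugraph set" where
  "spiro_chains q h k =
     {chain_of_cycles q k x y | x y.
        \<forall>i<k. x i \<in> verts (cycle_graph q) \<and> y i \<in> verts (cycle_graph q) \<and>
              graph_dist (cycle_graph q) (x i) (y i) = enat h}"

lemma spiro_chains_1_nonempty:
  assumes "q \<ge> 3"
  shows "spiro_chains q 1 k \<noteq> {}"
proof -
  let ?W = "{n. (0, 1) \<in> {(a, b). {a, b} \<in> edges (cycle_graph q)} ^^ n}"
  have "{0, (0 + 1) mod q} \<in> edges (cycle_graph q)"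
    unfolding cycle_graph_def using assms by fastforce
  then have "{0, 1} \<in> edges (cycle_graph q)"
    using assms by simp
  then have 1: "1 \<in> ?W"
    by (simp only: mem_Collect_eq relpow_1 case_prod_conv)
  have 0: "1 \<le> n" if "n \<in> ?W" for n
    using that by (cases n) auto
  have "graph_dist (cycle_graph q) 0 1 = enat 1"
    unfolding graph_dist_def
  proof (rule antisym)
    show "(INF n\<in>?W. enat n) \<le> enat 1"
      by (rule INF_lower[OF 1])
    show "enat 1 \<le> (INF n\<in>?W. enat n)"
      using 0 by (intro INF_greatest) (simp only: enat_ord_simps)
  qed
  moreover have "0 \<in> verts (cycle_graph q)" "1 \<in> verts (cycle_graph q)"
    using assms by (auto simp: cycle_graph_def)
  ultimately have "chain_of_cycles q k (\<lambda>_. 0) (\<lambda>_. 1) \<in> spiro_chains q 1 k"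
    unfolding spiro_chains_def by blast
  then show ?thesis by blast
qed

end

theory Submission imports Defs begin

text \<open>Identifying contact vertices merges no two edges: two different copies of the cycle share at
  most one vertex, while an edge has two ends in the same copy. So the chain has the \<open>q k\<close> edges of
  the disjoint cycles (lemma \<open>inj_on_edges\<close>), and the degree of a merged vertex is the sum of the
  degrees of the vertices that it is made of (lemma \<open>degree_identify\<close>). As every vertex of
  a cycle has degree 2 and at most two vertices are merged into one, contact vertices have degree 4
  and all others degree 2.

  An edge with an end of degree 2 contributes \<open>sqrt (d / (2 d)) = 1 / sqrt 2\<close> whatever the degree
  \<open>d\<close> of the other end is. Only an edge between two vertices of degree 4 is different; it contributes
  \<open>sqrt (6 / 16) = sqrt 6 / 4\<close>. Both ends of such an edge are contact vertices of one copy. An end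
  copy has only one of these, and each of the \<open>k - 2\<close> inner copies has two, which are adjacent
  because their distance is 1. So exactly \<open>k - 2\<close> edges contribute \<open>sqrt 6 / 4\<close>
  (lemma \<open>ABC_chain\<close>).\<close>

section \<open>Vertices at distance one\<close>

text \<open>The distance is an infimum of walk lengths. Being positive, it excludes the empty walk; being
  less than 2, it then leaves only a walk of length 1 to attain it.\<close>

lemma graph_dist_eq_1_imp_adjacent:
  assumes "graph_dist G u v = enat 1"
  shows "u \<noteq> v" and "{u, v} \<in> edges G"
proof -
  let ?A = "{(a, b). {a, b} \<in> edges G}"
  let ?W = "{n. (u, v) \<in> ?A ^^ n}"
  have inf: "(INF n\<in>?W. enat n) = enat 1"
    using assms unfolding graph_dist_def .
  have 0: "0 \<notin> ?W"
  proof
    assume "0 \<in> ?W"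
    then have "(INF n\<in>?W. enat n) \<le> enat 0" by (rule INF_lower)
    then show False unfolding inf by simp
  qed
  then show "u \<noteq> v" by auto
  have "1 \<in> ?W"
  proof (rule ccontr)
    assume 1: "1 \<notin> ?W"
    have "enat 2 \<le> enat n" if "n \<in> ?W" for n
    proof -
      have "n \<noteq> 0" "n \<noteq> 1" using 0 1 that by metis+
      then show ?thesis by simp
    qed
    then have "enat 2 \<le> (INF n\<in>?W. enat n)" by (rule INF_greatest)
    then show False unfolding inf by simp
  qed
  then show "{u, v} \<in> edges G"
    by (simp only: mem_Collect_eq relpow_1 case_prod_conv)
qed

section \<open>Cycles and their disjoint copies\<close>

lemma edges_cycle_graph: "edges (cycle_graph q) = (\<lambda>i. {i, (i + 1) mod q}) ` {..<q}"
  by (auto simp: cycle_graph_def)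

lemma finite_edges_cycle_graph [simp]: "finite (edges (cycle_graph q))"
  by (simp add: edges_cycle_graph)

lemma edge_cycle_graphE:
  assumes "e \<in> edges (cycle_graph q)" "q \<ge> 3"
  obtains u v where "e = {u, v}" "u \<noteq> v" "u < q" "v < q"
proof -
  obtain i where i: "i < q" "e = {i, (i + 1) mod q}"
    using assms(1) by (auto simp: edges_cycle_graph)
  have "i \<noteq> (i + 1) mod q" "(i + 1) mod q < q"
    using i assms(2) by (auto simp: mod_if)
  then show ?thesis using that i by blast
qed

text \<open>For \<open>q = 2\<close> this fails, as both indices then give the edge \<open>{0, 1}\<close>.\<close>

lemma inj_on_cycle_edge:
  fixes q :: nat
  assumes "q \<ge> 3"
  shows "inj_on (\<lambda>i. {i, (i + 1) mod q}) {..<q}"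
proof (rule inj_onI)
  fix i j assume ij: "i \<in> {..<q}" "j \<in> {..<q}" "{i, (i + 1) mod q} = {j, (j + 1) mod q}"
  then show "i = j"
    using assms by (auto simp: doubleton_eq_iff mod_if split: if_splits)
qed

lemma card_edges_cycle_graph:
  "q \<ge> 3 \<Longrightarrow> card (edges (cycle_graph q)) = q"
  unfolding edges_cycle_graph using card_image[OF inj_on_cycle_edge] by simp

lemma degree_cycle_graph:
  assumes "q \<ge> 3" "v < q"
  shows "degree (cycle_graph q) v = 2"
proof -
  define p where "p = (if v = 0 then q - 1 else v - 1)"
  have p: "p < q" "p \<noteq> v" "\<And>i. i < q \<Longrightarrow> (i + 1) mod q = v \<longleftrightarrow> i = p"
    using assms by (auto simp: p_def mod_if)
  have "{e \<in> edges (cycle_graph q). v \<in> e} = (\<lambda>i. {i, (i + 1) mod q}) ` {v, p}"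
    using p assms by (auto simp: edges_cycle_graph)
  also have "card \<dots> = card {v, p}"
    using p(1) assms(2)
    by (intro card_image inj_on_subset[OF inj_on_cycle_edge[OF assms(1)]]) auto
  finally show ?thesis using p by (simp add: degree_def)
qed

lemma edges_disjoint_copies:
  "edges (disjoint_copies k G) = (\<lambda>(i, e). Pair i ` e) ` ({..<k} \<times> edges G)"
  by (force simp: disjoint_copies_def)

lemma degree_disjoint_copies:
  assumes "i < k"
  shows "degree (disjoint_copies k G) (i, v) = degree G v"
proof -
  have "{e \<in> edges (disjoint_copies k G). (i, v) \<in> e} = (`) (Pair i) ` {e \<in> edges G. v \<in> e}"
    using assms by (auto simp: edges_disjoint_copies)
  moreover have "inj_on ((`) (Pair i)) {e \<in> edges G. v \<in> e}"
    by (rule inj_on_image) (simp add: inj_on_def)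
  ultimately show ?thesis by (simp add: degree_def card_image)
qed

section \<open>Identification of vertices\<close>

definition cls :: "('a \<Rightarrow> 'a \<Rightarrow> bool) \<Rightarrow> 'a \<Rightarrow> 'a set" where
  "cls R v = {w. equivclp R v w}"

lemma cls_eq_iff: "cls R v = cls R w \<longleftrightarrow> equivclp R v w"
  by (auto simp: cls_def intro: equivclp_trans equivclp_sym)

lemma edges_identify: "edges (identify R G) = (`) (cls R) ` edges G"
  by (simp add: identify_def Let_def cls_def[abs_def])

text \<open>Since no edges are merged, the edges at a class are those at one of its members; since no edge
  has two ends in one class, they are counted only once.\<close>

lemma degree_identify:
  assumes fin: "finite (edges G)" "finite (cls R v)"
    and inj: "inj_on ((`) (cls R)) (edges G)"
    and inj_edge: "\<And>e. e \<in> edges G \<Longrightarrow> inj_on (cls R) e"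
  shows "degree (identify R G) (cls R v) = (\<Sum>w\<in>cls R v. degree G w)"
proof -
  have "cls R v \<in> cls R ` e \<longleftrightarrow> (\<exists>w\<in>e. equivclp R v w)" for e
    unfolding image_iff by (simp add: cls_eq_iff)
  then have "{e \<in> edges (identify R G). cls R v \<in> e} =
      (`) (cls R) ` {e \<in> edges G. \<exists>w\<in>e. equivclp R v w}"
    by (simp only: edges_identify Compr_image_eq)
  then have "degree (identify R G) (cls R v) = card {e \<in> edges G. \<exists>w\<in>e. equivclp R v w}"
    unfolding degree_def by (simp add: card_image inj_on_subset[OF inj])
  also have "{e \<in> edges G. \<exists>w\<in>e. equivclp R v w} = (\<Union>w\<in>cls R v. {e \<in> edges G. w \<in> e})"
    by (auto simp: cls_def)
  also have "card \<dots> = (\<Sum>w\<in>cls R v. card {e \<in> edges G. w \<in> e})"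
  proof (rule card_UN_disjoint)
    show "\<forall>w\<in>cls R v. \<forall>w'\<in>cls R v. w \<noteq> w' \<longrightarrow>
        {e \<in> edges G. w \<in> e} \<inter> {e \<in> edges G. w' \<in> e} = {}"
    proof (intro ballI impI)
      fix w w' assume w: "w \<in> cls R v" "w' \<in> cls R v" "w \<noteq> w'"
      then have "cls R w = cls R w'"
        unfolding cls_eq_iff by (auto simp: cls_def intro: equivclp_trans equivclp_sym)
      then show "{e \<in> edges G. w \<in> e} \<inter> {e \<in> edges G. w' \<in> e} = {}"
        using inj_edge w(3) by (auto dest: inj_onD)
    qed
  qed (use fin in auto)
  finally show ?thesis by (simp add: degree_def)
qed

section \<open>Chains of cycles\<close>

locale cycle_chain =
  fixes q k :: nat and x y :: "nat \<Rightarrow> nat"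
  assumes q: "q \<ge> 3"
    and contact: "i < k \<Longrightarrow> x i < q" "i < k \<Longrightarrow> y i < q" "i < k \<Longrightarrow> x i \<noteq> y i"
begin

definition glue :: "nat \<times> nat \<Rightarrow> nat \<times> nat \<Rightarrow> bool" where
  "glue = (\<lambda>a b. \<exists>i. i + 1 < k \<and> a = (i, y i) \<and> b = (i + 1, x (i + 1)))"

abbreviation "cycles \<equiv> disjoint_copies k (cycle_graph q)"

abbreviation "chain \<equiv> chain_of_cycles q k x y"

lemma chain_eq: "chain = identify glue cycles"
  by (simp add: chain_of_cycles_def glue_def)

text \<open>The member of the class that lies in the earlier copy. As \<open>x i \<noteq> y i\<close>, it is not itself glued
  to a still earlier copy, so one step back always suffices.\<close>

definition rep :: "nat \<times> nat \<Rightarrow> nat \<times> nat" where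
  "rep = (\<lambda>(i, v). if 0 < i \<and> i < k \<and> v = x i then (i - 1, y (i - 1)) else (i, v))"

lemma equivclp_glue_iff: "equivclp glue a b \<longleftrightarrow> rep a = rep b"
proof
  have glue_rep: "rep c = rep d" if "glue c d" for c d
  proof -
    obtain i where "i + 1 < k" "c = (i, y i)" "d = (i + 1, x (i + 1))"
      using \<open>glue c d\<close> unfolding glue_def by blast
    moreover from \<open>i + 1 < k\<close> have "x i \<noteq> y i" using contact(3)[of i] by simp
    ultimately show ?thesis by (simp add: rep_def)
  qed
  assume "equivclp glue a b"
  then show "rep a = rep b"
    by (induction rule: equivclp_induct) (auto dest: glue_rep)
next
  have to_rep: "equivclp glue c (rep c)" for c
  proof (cases "rep c = c")
    case False
    then have "glue (rep c) c"
      by (cases c) (auto simp: rep_def glue_def split: if_splits)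
    then show ?thesis by (intro equivclp_sym[OF r_into_equivclp])
  qed simp
  assume "rep a = rep b"
  then show "equivclp glue a b"
    using to_rep[of a] to_rep[of b] by (metis equivclp_sym equivclp_trans)
qed

lemma equivclp_glue_same_copy: "equivclp glue (i, u) (i, v) \<longleftrightarrow> u = v"
  by (auto simp: equivclp_glue_iff rep_def split: if_splits)

text \<open>The vertex that copy \<open>i\<close> can share with copy \<open>j\<close> depends only on \<open>i\<close> and \<open>j\<close>; so there is at
  most one.\<close>

lemma equivclp_glue_other_copy:
  assumes "equivclp glue (i, u) (j, v)" "i \<noteq> j"
  shows "u = (if i < j then y i else x i)"
  using assms by (auto simp: equivclp_glue_iff rep_def split: if_splits)

text \<open>Equal images of two edges in different copies would put both ends of an edge on the one vertex
  that the copies can share. Within a copy, distinct vertices are never identified.\<close>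

lemma inj_on_edges: "inj_on ((`) (cls glue)) (edges cycles)"
proof (rule inj_onI)
  fix e f assume ef: "e \<in> edges cycles" "f \<in> edges cycles" "cls glue ` e = cls glue ` f"
  obtain i e' where e: "e = Pair i ` e'" "e' \<in> edges (cycle_graph q)"
    using ef by (auto simp: edges_disjoint_copies)
  obtain j f' where f: "f = Pair j ` f'" "f' \<in> edges (cycle_graph q)"
    using ef by (auto simp: edges_disjoint_copies)
  have ef_sub: "\<exists>v\<in>f'. equivclp glue (i, u) (j, v)" if "u \<in> e'" for u
  proof -
    have "cls glue (i, u) \<in> cls glue ` f" using that e ef(3) by blast
    then show ?thesis using f by (auto simp: cls_eq_iff)
  qed
  have fe_sub: "\<exists>u\<in>e'. equivclp glue (j, v) (i, u)" if "v \<in> f'" for v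
  proof -
    have "cls glue (j, v) \<in> cls glue ` e" using that f ef(3) by blast
    then show ?thesis using e by (auto simp: cls_eq_iff)
  qed
  have "i = j"
  proof (rule ccontr)
    assume "i \<noteq> j"
    then have "u = (if i < j then y i else x i)" if "u \<in> e'" for u
      using ef_sub[OF that] equivclp_glue_other_copy by blast
    moreover obtain u v where "e' = {u, v}" "u \<noteq> v"
      using edge_cycle_graphE[OF e(2) q] by blast
    ultimately show False by (metis insertI1 insertI2)
  qed
  then have "e' = f'"
    using ef_sub fe_sub by (auto simp: equivclp_glue_same_copy)
  with \<open>i = j\<close> show "e = f" using e f by simp
qed

lemma inj_on_edge: "e \<in> edges cycles \<Longrightarrow> inj_on (cls glue) e"
  by (auto simp: edges_disjoint_copies inj_on_def cls_eq_iff equivclp_glue_same_copy)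

definition is_contact :: "nat \<Rightarrow> nat \<Rightarrow> bool" where
  "is_contact i v \<longleftrightarrow> (0 < i \<and> v = x i) \<or> (i + 1 < k \<and> v = y i)"

lemma cls_glue:
  assumes "i < k"
  shows "cls glue (i, v) =
    (if 0 < i \<and> v = x i then {(i - 1, y (i - 1)), (i, x i)}
     else if i + 1 < k \<and> v = y i then {(i, y i), (i + 1, x (i + 1))}
     else {(i, v)})"
proof -
  have eq_contact: "rep a = (j, y j) \<longleftrightarrow> a = (j, y j) \<or> a = (j + 1, x (j + 1))"
    if "j + 1 < k" for j a
  proof -
    have "y j \<noteq> x j" by (rule not_sym, rule contact(3)) (use that in simp)
    then show ?thesis using that by (cases a) (auto simp: rep_def)
  qed
  have cls_rep: "cls glue (i, v) = {a. rep a = rep (i, v)}"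
    by (auto simp: cls_def equivclp_glue_iff)
  consider (left) "0 < i" "v = x i" | (right) "\<not> (0 < i \<and> v = x i)" "i + 1 < k" "v = y i"
    | (none) "\<not> (0 < i \<and> v = x i)" "\<not> (i + 1 < k \<and> v = y i)" by blast
  then show ?thesis
  proof cases
    case left
    then have "rep (i, v) = (i - 1, y (i - 1))" using assms by (simp add: rep_def)
    then have "cls glue (i, v) = {(i - 1, y (i - 1)), (i, x i)}"
      unfolding cls_rep by (simp only:) (use eq_contact[of "i - 1"] left assms in auto)
    with left show ?thesis by simp
  next
    case right
    then have "rep (i, v) = (i, y i)" by (auto simp: rep_def)
    then have "cls glue (i, v) = {(i, y i), (i + 1, x (i + 1))}"
      unfolding cls_rep by (simp only:) (use eq_contact[of i] right in auto)
    with right(2,3) show ?thesis unfolding if_not_P[OF right(1)] by simp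
  next
    case none
    then have rep_self: "rep (i, v) = (i, v)" by (auto simp: rep_def)
    have "rep a = (i, v) \<longleftrightarrow> a = (i, v)" for a
      using none by (cases a) (auto simp: rep_def)
    then have "cls glue (i, v) = {(i, v)}" unfolding cls_rep rep_self by simp
    then show ?thesis unfolding if_not_P[OF none(1)] if_not_P[OF none(2)] .
  qed
qed

lemma degree_chain:
  assumes "i < k" "v < q"
  shows "degree chain (cls glue (i, v)) = (if is_contact i v then 4 else 2)"
proof -
  have members: "j < k \<and> w < q" if "(j, w) \<in> cls glue (i, v)" for j w
    using that assms contact(1)[of i] contact(1)[of "i + 1"]
      contact(2)[of i] contact(2)[of "i - 1"]
    unfolding cls_glue[OF assms(1)] by (auto split: if_splits)
  have fin: "finite (cls glue (i, v))"
    unfolding cls_glue[OF assms(1)] by simp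
  have "degree chain (cls glue (i, v)) = (\<Sum>w\<in>cls glue (i, v). degree cycles w)"
    unfolding chain_eq
    using fin inj_on_edges inj_on_edge
    by (intro degree_identify) (auto simp: edges_disjoint_copies)
  also have "\<dots> = (\<Sum>w\<in>cls glue (i, v). 2)"
  proof (rule sum.cong[OF refl])
    fix w assume "w \<in> cls glue (i, v)"
    moreover obtain j w' where "w = (j, w')" by (cases w)
    ultimately show "degree cycles w = 2"
      using members by (simp add: degree_disjoint_copies degree_cycle_graph q)
  qed
  also have "\<dots> = 2 * card (cls glue (i, v))" by simp
  also have "card (cls glue (i, v)) = (if is_contact i v then 2 else 1)"
    unfolding cls_glue[OF assms(1)] is_contact_def by (cases i) auto
  finally show ?thesis by simp
qed

section \<open>The index of the chain\<close>

text \<open>The two ends of an edge are different, so they are both contact vertices only if the edge joins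
  \<open>x i\<close> to \<open>y i\<close> and both of these are glued to a neighbouring copy.\<close>

lemma edge_weight:
  assumes "i < k" "e \<in> edges (cycle_graph q)"
  shows "sqrt (((\<Sum>v\<in>cls glue ` Pair i ` e. real (degree chain v)) - 2)
      / (\<Prod>v\<in>cls glue ` Pair i ` e. real (degree chain v))) =
    (if 0 < i \<and> i + 1 < k \<and> e = {x i, y i} then sqrt 6 / 4 else 1 / sqrt 2)"
proof -
  obtain u v where e: "e = {u, v}" "u \<noteq> v" "u < q" "v < q"
    by (rule edge_cycle_graphE[OF assms(2) q])
  let ?d = "\<lambda>w. if is_contact i w then 4 else 2 :: real"
  have "cls glue (i, u) \<noteq> cls glue (i, v)"
    using e(2) by (simp only: cls_eq_iff equivclp_glue_same_copy not_False_eq_True)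
  then have "sqrt (((\<Sum>v\<in>cls glue ` Pair i ` e. real (degree chain v)) - 2)
      / (\<Prod>v\<in>cls glue ` Pair i ` e. real (degree chain v))) =
      sqrt ((?d u + ?d v - 2) / (?d u * ?d v))"
    using e assms(1) by (simp add: degree_chain)
  also have "\<dots> = (if is_contact i u \<and> is_contact i v then sqrt (6 / 16) else sqrt (1 / 2))"
    by simp
  also have "is_contact i u \<and> is_contact i v \<longleftrightarrow> 0 < i \<and> i + 1 < k \<and> e = {x i, y i}"
    using e contact(3)[OF assms(1)] by (auto simp: is_contact_def doubleton_eq_iff)
  also have "sqrt (6 / 16) = sqrt 6 / 4"
    by (rule real_sqrt_unique) (simp_all add: power_divide)
  also have "sqrt (1 / 2) = 1 / sqrt 2"
    by (simp add: real_sqrt_divide)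
  finally show ?thesis .
qed

lemma ABC_chain:
  assumes "k \<ge> 2" and adj: "\<And>i. i < k \<Longrightarrow> {x i, y i} \<in> edges (cycle_graph q)"
  shows "ABC chain = (real q * real k - real k + 2) / sqrt 2 + (real k - 2) * sqrt 6 / 4"
proof -
  let ?C = "edges (cycle_graph q)"
  let ?w = "\<lambda>e. sqrt (((\<Sum>v\<in>e. real (degree chain v)) - 2) / (\<Prod>v\<in>e. real (degree chain v)))"
  \<comment> \<open>the excess of an edge between two contact vertices over the value \<open>1 / sqrt 2\<close> that every
    other edge contributes\<close>
  define d where "d = sqrt 6 / 4 - 1 / sqrt 2"
  have inj: "inj_on (\<lambda>(i, e). Pair i ` e) ({..<k} \<times> ?C)"
  proof -
    have copy_eq: "i = j \<and> e = f" if e: "e \<in> ?C" and eq: "Pair i ` e = Pair j ` f" for i j :: nat and e f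
    proof -
      obtain u v where "e = {u, v}"
        using edge_cycle_graphE[OF e q] .
      then have "(i, u) \<in> Pair j ` f" using eq by (metis imageI insertI1)
      then have "i = j" by auto
      then show ?thesis using eq by (simp add: inj_image_eq_iff inj_def)
    qed
    show ?thesis by (auto intro!: inj_onI dest: copy_eq)
  qed
  have "ABC chain = (\<Sum>e\<in>edges cycles. ?w (cls glue ` e))"
    unfolding ABC_def chain_eq edges_identify
    by (simp add: sum.reindex[OF inj_on_edges])
  also have "\<dots> = (\<Sum>i<k. \<Sum>e\<in>?C. ?w (cls glue ` Pair i ` e))"
    unfolding edges_disjoint_copies sum.reindex[OF inj] sum.cartesian_product
    by (simp add: case_prod_unfold)
  also have "\<dots> = (\<Sum>i<k. real q / sqrt 2 + (if i \<in> {1..<k - 1} then d else 0))"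
  proof (rule sum.cong[OF refl])
    fix i assume "i \<in> {..<k}"
    then have i: "i < k" by simp
    let ?inner = "i \<in> {1..<k - 1}"
    have "(\<Sum>e\<in>?C. ?w (cls glue ` Pair i ` e)) =
        (\<Sum>e\<in>?C. 1 / sqrt 2 + (if e = {x i, y i} then (if ?inner then d else 0) else 0))"
    proof (rule sum.cong[OF refl])
      fix e assume e: "e \<in> ?C"
      have inner: "?inner \<longleftrightarrow> 0 < i \<and> i + 1 < k" by auto
      show "?w (cls glue ` Pair i ` e) =
          1 / sqrt 2 + (if e = {x i, y i} then (if ?inner then d else 0) else 0)"
        unfolding edge_weight[OF i e] inner d_def by simp
    qed
    also have "\<dots> = real q / sqrt 2 + (if ?inner then d else 0)"
      unfolding sum.distrib sum.delta[OF finite_edges_cycle_graph]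
      using adj[OF i] by (simp add: card_edges_cycle_graph[OF q])
    finally show "(\<Sum>e\<in>?C. ?w (cls glue ` Pair i ` e)) =
        real q / sqrt 2 + (if ?inner then d else 0)" .
  qed
  also have "\<dots> = real k * (real q / sqrt 2) + (\<Sum>i\<in>{..<k} \<inter> {1..<k - 1}. d)"
    unfolding sum.distrib sum.inter_restrict[OF finite_lessThan] by simp
  also have "{..<k} \<inter> {1..<k - 1} = {1..<k - 1}" by auto
  also have "(\<Sum>i\<in>{1..<k - 1}. d) = (real k - 2) * d"
    using assms(1) by simp
  also have "real k * (real q / sqrt 2) + (real k - 2) * d =
      (real q * real k - real k + 2) / sqrt 2 + (real k - 2) * sqrt 6 / 4"
    by (simp add: d_def diff_divide_distrib add_divide_distrib algebra_simps)
  finally show ?thesis .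
qed

end

theorem theorem3p2:
  fixes q k :: nat and S :: "(nat \<times> nat) set ugraph"
  assumes "q \<ge> 3" and "k \<ge> 2" and "S \<in> spiro_chains q 1 k"
  shows "ABC S = (real q * real k - real k + 2) / sqrt 2 + (real k - 2) * sqrt 6 / 4"
proof -
  obtain x y where S: "S = chain_of_cycles q k x y"
    and xy: "\<forall>i<k. x i \<in> verts (cycle_graph q) \<and> y i \<in> verts (cycle_graph q) \<and>
      graph_dist (cycle_graph q) (x i) (y i) = enat 1"
    using assms(3) unfolding spiro_chains_def mem_Collect_eq by (elim exE conjE) (rule that)
  have adj: "x i \<noteq> y i" "{x i, y i} \<in> edges (cycle_graph q)" if "i < k" for i
  proof -
    have "graph_dist (cycle_graph q) (x i) (y i) = enat 1" using xy that by blast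
    then show "x i \<noteq> y i" "{x i, y i} \<in> edges (cycle_graph q)"
      by (rule graph_dist_eq_1_imp_adjacent)+
  qed
  interpret cycle_chain q k x y
    using assms(1) xy adj(1) by unfold_locales (auto simp: cycle_graph_def)
  show ?thesis unfolding S by (rule ABC_chain[OF assms(2) adj(2)])
qed

end
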